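(* Let $p\ge3$ be a prime, $q\ge1$ an integer, $\theta=p^N$ with $N\ge1$ (so $|\theta|_p<1$), and assume that the dynamical system $f(x)=\left(\frac{\theta x+q}{x+\theta+q-1}\right)^2$ on $\mathbb{Q}_p$ has three fixed points $x_0,x_1,x_2$. Then: (i) if $|q|_p=1$, then the fixed points are neutral; (ii) if $|q|_p<1$ and $|\theta|_p\le|q|_p^2$, then $x_1$ is attractive, and $x_0$, $x_2$ are repelling.
   Context: $|\cdot|_p$ is the $p$-adic absolute value. The fixed points of $f$ are $x_0=1$ and the roots $x_1,x_2$ of $x^2+(2\theta-\theta^2+2q-1)x+q^2=0$ (assumed to lie in $\mathbb{Q}_p$); when $|q|_p<1$ they are labelled so that $|x_1|_p=|q|_p^2$ and $|x_2|_p=1$. A fixed point $x$ with $\lambda=f'(x)$ is attractive if $|\lambda|_p<1$, neutral (indifferent) if $|\lambda|_p=1$, and repelling if $|\lambda|_p>1$. *)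

theory Defs
  imports Complex_Main "HOL-Computational_Algebra.Squarefree" "Berlekamp_Zassenhaus.Finite_Field"
begin

section \<open>The \<open>p\<close>-adic absolute value on the rationals\<close>

definition padic_abs :: "nat \<Rightarrow> rat \<Rightarrow> real" where
  "padic_abs p x = (if x = 0 then 0 else
     (case quotient_of x of (a, b) \<Rightarrow>
        real p powi (int (multiplicity (int p) b) - int (multiplicity (int p) a))))"

lemma padic_abs_0 [simp]: "padic_abs p 0 = 0"
  by (simp add: padic_abs_def)

context
  fixes p :: nat
  assumes p: "prime p"
begin

lemma p_gt_1: "real p > 1"
  using prime_gt_1_nat[OF p] by simp

lemma padic_abs_Fract:
  assumes "a \<noteq> 0" "b \<noteq> 0"
  shows "padic_abs p (of_int a / of_int b) =
           real p powi (int (multiplicity (int p) b) - int (multiplicity (int p) a))"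
proof -
  obtain c d where cd: "quotient_of (of_int a / of_int b) = (c, d)"
    by (cases "quotient_of (of_int a / of_int b)")
  have d: "d > 0" and eq: "(of_int a / of_int b :: rat) = of_int c / of_int d"
    using quotient_of_denom_pos[OF cd] quotient_of_div[OF cd] by auto
  have c: "c \<noteq> 0" using eq assms d by auto
  have "of_int (a * d) = (of_int (c * b) :: rat)"
    using eq assms d by (simp add: field_simps)
  then have "a * d = c * b" by (simp only: of_int_eq_iff)
  then have "multiplicity (int p) (a * d) = multiplicity (int p) (c * b)" by simp
  then have "multiplicity (int p) a + multiplicity (int p) d
      = multiplicity (int p) c + multiplicity (int p) b"
    using assms c d p by (simp add: prime_elem_multiplicity_mult_distrib)
  then have "int (multiplicity (int p) d) - int (multiplicity (int p) c)
      = int (multiplicity (int p) b) - int (multiplicity (int p) a)" by linarith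
  then show ?thesis using assms cd by (simp add: padic_abs_def)
qed

lemma rat_cases_nz:
  assumes "(x::rat) \<noteq> 0"
  obtains a b where "a \<noteq> 0" "b \<noteq> 0" "x = of_int a / of_int b"
proof -
  obtain c d where cd: "quotient_of x = (c, d)" by (cases "quotient_of x")
  have "d > 0" "x = of_int c / of_int d"
    using quotient_of_denom_pos[OF cd] quotient_of_div[OF cd] by auto
  then show ?thesis using that[of c d] assms by auto
qed

lemma padic_abs_pos: "x \<noteq> 0 \<Longrightarrow> padic_abs p x > 0"
  using p_gt_1 by (auto simp: padic_abs_def split: prod.split)

lemma padic_abs_nonneg [simp]: "padic_abs p x \<ge> 0"
  using padic_abs_pos[of x] by (cases "x = 0") auto

lemma padic_abs_eq_0 [simp]: "padic_abs p x = 0 \<longleftrightarrow> x = 0"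
  using padic_abs_pos[of x] by (cases "x = 0") auto

lemma padic_abs_mult: "padic_abs p (x * y) = padic_abs p x * padic_abs p y"
proof (cases "x = 0 \<or> y = 0")
  case False
  then obtain a b c d where *: "a \<noteq> 0" "b \<noteq> 0" "x = of_int a / of_int b"
    "c \<noteq> 0" "d \<noteq> 0" "y = of_int c / of_int d"
    by (metis rat_cases_nz)
  let ?v = "\<lambda>z. int (multiplicity (int p) z)"
  have nz: "a * c \<noteq> 0" "b * d \<noteq> 0" using * by auto
  have "?v (b * d) - ?v (a * c) = (?v b - ?v a) + (?v d - ?v c)"
    using * p by (simp add: prime_elem_multiplicity_mult_distrib)
  then have "real p powi (?v (b * d) - ?v (a * c)) = real p powi (?v b - ?v a) * real p powi (?v d - ?v c)"
    using p_gt_1 by (simp only:) (rule power_int_add, simp)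
  moreover have "x * y = of_int (a * c) / of_int (b * d)" using * by simp
  ultimately show ?thesis
    unfolding *(3,6) using padic_abs_Fract[OF nz] padic_abs_Fract[OF *(1,2)] padic_abs_Fract[OF *(4,5)]
    by simp
qed auto

lemma padic_abs_1 [simp]: "padic_abs p 1 = 1"
  using padic_abs_Fract[of 1 1] by simp

lemma padic_abs_minus [simp]: "padic_abs p (- x) = padic_abs p x"
proof (cases "x = 0")
  case False
  then obtain a b where *: "a \<noteq> 0" "b \<noteq> 0" "x = of_int a / of_int b"
    by (metis rat_cases_nz)
  moreover have "multiplicity (int p) (- a) = multiplicity (int p) a"
    by (rule multiplicity_uminus_right)
  ultimately show ?thesis using padic_abs_Fract[of "- a" b] padic_abs_Fract[of a b] by simp
qed auto

lemma padic_abs_inverse: "padic_abs p (inverse x) = inverse (padic_abs p x)"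
proof (cases "x = 0")
  case False
  then have "padic_abs p (inverse x) * padic_abs p x = 1"
    by (simp flip: padic_abs_mult)
  then show ?thesis using False by (simp add: field_simps)
qed auto

lemma padic_abs_prime: "padic_abs p (of_nat p) = 1 / real p"
proof -
  have "multiplicity (int p) (int p) = 1"
    using p by (intro multiplicity_self) auto
  then show ?thesis
    using padic_abs_Fract[of "int p" 1] prime_gt_1_nat[OF p] by (simp add: power_int_minus field_simps)
qed

lemma padic_abs_ultra: "padic_abs p (x + y) \<le> max (padic_abs p x) (padic_abs p y)"
proof (cases "x = 0 \<or> y = 0 \<or> x + y = 0")
  case False
  then obtain a b c d where *: "a \<noteq> 0" "b \<noteq> 0" "x = of_int a / of_int b"
    "c \<noteq> 0" "d \<noteq> 0" "y = of_int c / of_int d"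
    by (metis rat_cases_nz)
  let ?v = "\<lambda>z. multiplicity (int p) z"
  let ?e = "b * d"
  have x: "x = of_int (a * d) / of_int ?e" and y: "y = of_int (c * b) / of_int ?e"
    and xy: "x + y = of_int (a * d + c * b) / of_int ?e"
    using * by (simp_all add: field_simps)
  have nz: "a * d \<noteq> 0" "c * b \<noteq> 0" "?e \<noteq> 0" using * by auto
  have nz': "a * d + c * b \<noteq> 0" using False xy by (metis div_0 of_int_0)
  have "int p ^ min (?v (a * d)) (?v (c * b)) dvd a * d + c * b"
    by (intro dvd_add multiplicity_dvd') simp_all
  then have "min (?v (a * d)) (?v (c * b)) \<le> ?v (a * d + c * b)"
    using nz' p by (intro multiplicity_geI) auto
  then consider "?v (a * d) \<le> ?v (a * d + c * b)" | "?v (c * b) \<le> ?v (a * d + c * b)"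
    by linarith
  then have "padic_abs p (x + y) \<le> padic_abs p x \<or> padic_abs p (x + y) \<le> padic_abs p y"
    using padic_abs_Fract[OF nz(1) nz(3)] padic_abs_Fract[OF nz(2) nz(3)]
      padic_abs_Fract[OF nz' nz(3)] p_gt_1 unfolding x[symmetric] y[symmetric] xy[symmetric]
    by cases (auto intro!: power_int_increasing)
  then show ?thesis by linarith
qed (auto simp: max_def)

lemma padic_abs_triangle: "padic_abs p (x + y) \<le> padic_abs p x + padic_abs p y"
  using padic_abs_ultra[of x y] padic_abs_nonneg[of x] padic_abs_nonneg[of y] by linarith

lemma padic_abs_diff_commute: "padic_abs p (x - y) = padic_abs p (y - x)"
  using padic_abs_minus[of "x - y"] by simp

lemma padic_abs_diff: "\<bar>padic_abs p x - padic_abs p y\<bar> \<le> padic_abs p (x - y)"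
  using padic_abs_triangle[of "x - y" y] padic_abs_triangle[of "y - x" x]
    padic_abs_diff_commute[of x y] by simp

end


lemma real_null_comparison:
  fixes f g :: "nat \<Rightarrow> real"
  assumes "eventually (\<lambda>n. norm (f n) \<le> g n) sequentially" "g \<longlonglongrightarrow> 0"
  shows "f \<longlonglongrightarrow> 0"
proof (rule tendsto_0_le[OF assms(2), where K = 1])
  show "eventually (\<lambda>n. norm (f n) \<le> norm (g n) * 1) sequentially"
    using assms(1) by (rule eventually_mono) auto
qed

section \<open>The field of \<open>p\<close>-adic numbers\<close>

text \<open>The completion of the rationals for the \<open>p\<close>-adic absolute value: Cauchy
  sequences modulo null sequences. The prime is \<open>CARD('p)\<close>, so that the
  construction is a type and can be made an instance of the algebraic and metric classes.\<close>

definition padic_null :: "nat \<Rightarrow> (nat \<Rightarrow> rat) \<Rightarrow> bool" where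
  "padic_null p X \<longleftrightarrow> (\<lambda>n. padic_abs p (X n)) \<longlonglongrightarrow> 0"

definition padic_Cauchy :: "nat \<Rightarrow> (nat \<Rightarrow> rat) \<Rightarrow> bool" where
  "padic_Cauchy p X \<longleftrightarrow> (\<forall>e>0. \<exists>M. \<forall>m\<ge>M. \<forall>n\<ge>M. padic_abs p (X m - X n) < e)"

definition padic_rel :: "nat \<Rightarrow> (nat \<Rightarrow> rat) \<Rightarrow> (nat \<Rightarrow> rat) \<Rightarrow> bool" where
  "padic_rel p X Y \<longleftrightarrow> padic_Cauchy p X \<and> padic_Cauchy p Y \<and> padic_null p (\<lambda>n. X n - Y n)"

context
  fixes p :: nat
  assumes p: "prime p"
begin

lemma padic_Cauchy_const [simp]: "padic_Cauchy p (\<lambda>n. c)"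
  by (simp add: padic_Cauchy_def)

lemma padic_null_0 [simp]: "padic_null p (\<lambda>n. 0)"
  by (simp add: padic_null_def)

lemma padic_null_const [simp]: "padic_null p (\<lambda>n. c) \<longleftrightarrow> c = 0"
  using p by (simp add: padic_null_def LIMSEQ_const_iff padic_abs_eq_0)

lemma padic_null_minus: "padic_null p X \<Longrightarrow> padic_null p (\<lambda>n. - X n)"
  using p by (simp add: padic_null_def padic_abs_minus)

lemma padic_null_add:
  assumes "padic_null p X" "padic_null p Y" shows "padic_null p (\<lambda>n. X n + Y n)"
proof -
  have "(\<lambda>n. padic_abs p (X n) + padic_abs p (Y n)) \<longlonglongrightarrow> 0"
    using tendsto_add[OF assms[unfolded padic_null_def]] by simp
  then show ?thesis unfolding padic_null_def
    by (rule real_null_comparison[rotated])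
      (use p in \<open>auto intro!: always_eventually padic_abs_triangle simp: padic_abs_nonneg\<close>)
qed

lemma padic_null_diff:
  "padic_null p X \<Longrightarrow> padic_null p Y \<Longrightarrow> padic_null p (\<lambda>n. X n - Y n)"
  unfolding diff_conv_add_uminus by (intro padic_null_add padic_null_minus)

lemma padic_Cauchy_add:
  assumes "padic_Cauchy p X" "padic_Cauchy p Y" shows "padic_Cauchy p (\<lambda>n. X n + Y n)"
  unfolding padic_Cauchy_def
proof (intro allI impI)
  fix e :: real assume e: "e > 0"
  obtain M1 where 1: "\<And>m n. m \<ge> M1 \<Longrightarrow> n \<ge> M1 \<Longrightarrow> padic_abs p (X m - X n) < e"
    using assms(1) e unfolding padic_Cauchy_def by blast
  obtain M2 where 2: "\<And>m n. m \<ge> M2 \<Longrightarrow> n \<ge> M2 \<Longrightarrow> padic_abs p (Y m - Y n) < e"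
    using assms(2) e unfolding padic_Cauchy_def by blast
  have "padic_abs p (X m + Y m - (X n + Y n)) < e" if "m \<ge> max M1 M2" "n \<ge> max M1 M2" for m n
    using padic_abs_ultra[OF p, of "X m - X n" "Y m - Y n"] 1[of m n] 2[of m n] that
    by (simp add: algebra_simps)
  then show "\<exists>M. \<forall>m\<ge>M. \<forall>n\<ge>M. padic_abs p (X m + Y m - (X n + Y n)) < e" by blast
qed

lemma padic_Cauchy_minus: "padic_Cauchy p X \<Longrightarrow> padic_Cauchy p (\<lambda>n. - X n)"
  unfolding padic_Cauchy_def minus_diff_minus padic_abs_minus[OF p] .

lemma padic_Cauchy_diff:
  "padic_Cauchy p X \<Longrightarrow> padic_Cauchy p Y \<Longrightarrow> padic_Cauchy p (\<lambda>n. X n - Y n)"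
  unfolding diff_conv_add_uminus by (intro padic_Cauchy_add padic_Cauchy_minus)

lemma padic_Cauchy_convergent:
  assumes "padic_Cauchy p X" shows "convergent (\<lambda>n. padic_abs p (X n))"
proof -
  have "Cauchy (\<lambda>n. padic_abs p (X n))"
    unfolding Cauchy_def dist_real_def
    using assms padic_abs_diff[OF p] unfolding padic_Cauchy_def by (meson le_less_trans)
  then show ?thesis by (rule real_Cauchy_convergent)
qed

lemma padic_Cauchy_bounded:
  assumes "padic_Cauchy p X" shows "\<exists>B>0. \<forall>n. padic_abs p (X n) \<le> B"
proof -
  have "Bseq (\<lambda>n. padic_abs p (X n))"
    using padic_Cauchy_convergent[OF assms] by (rule convergent_imp_Bseq)
  then obtain B where B: "B > 0" "\<forall>n. norm (padic_abs p (X n)) \<le> B"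
    unfolding Bseq_def by blast
  then show ?thesis using padic_abs_nonneg[OF p] by auto
qed

lemma padic_null_mult:
  assumes "padic_Cauchy p X" "padic_null p Y" shows "padic_null p (\<lambda>n. X n * Y n)"
proof -
  obtain L where "(\<lambda>n. padic_abs p (X n)) \<longlonglongrightarrow> L"
    using padic_Cauchy_convergent[OF assms(1)] by (auto simp: convergent_def)
  from tendsto_mult[OF this assms(2)[unfolded padic_null_def]] show ?thesis
    by (simp add: padic_null_def padic_abs_mult[OF p])
qed

lemma padic_Cauchy_mult:
  assumes "padic_Cauchy p X" "padic_Cauchy p Y" shows "padic_Cauchy p (\<lambda>n. X n * Y n)"
  unfolding padic_Cauchy_def
proof (intro allI impI)
  fix e :: real assume e: "e > 0"
  obtain A where A: "A > 0" "\<And>n. padic_abs p (X n) \<le> A" using padic_Cauchy_bounded[OF assms(1)] by blast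
  obtain B where B: "B > 0" "\<And>n. padic_abs p (Y n) \<le> B" using padic_Cauchy_bounded[OF assms(2)] by blast
  obtain M1 where 1: "\<And>m n. m \<ge> M1 \<Longrightarrow> n \<ge> M1 \<Longrightarrow> padic_abs p (X m - X n) < e / B"
    using assms(1) e B(1) unfolding padic_Cauchy_def by (meson divide_pos_pos)
  obtain M2 where 2: "\<And>m n. m \<ge> M2 \<Longrightarrow> n \<ge> M2 \<Longrightarrow> padic_abs p (Y m - Y n) < e / A"
    using assms(2) e A(1) unfolding padic_Cauchy_def by (meson divide_pos_pos)
  have "padic_abs p (X m * Y m - X n * Y n) < e" if "m \<ge> max M1 M2" "n \<ge> max M1 M2" for m n
  proof -
    have "padic_abs p (X m) * padic_abs p (Y m - Y n) \<le> A * padic_abs p (Y m - Y n)"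
      using A padic_abs_nonneg[OF p] by (intro mult_right_mono) auto
    also have "\<dots> < A * (e / A)" using 2 that A by (intro mult_strict_left_mono) auto
    finally have a: "padic_abs p (X m * (Y m - Y n)) < e" using A by (simp add: padic_abs_mult[OF p])
    have "padic_abs p (X m - X n) * padic_abs p (Y n) \<le> padic_abs p (X m - X n) * B"
      using B padic_abs_nonneg[OF p] by (intro mult_left_mono) auto
    also have "\<dots> < (e / B) * B" using 1 that B by (intro mult_strict_right_mono) auto
    finally have b: "padic_abs p ((X m - X n) * Y n) < e" using B by (simp add: padic_abs_mult[OF p])
    show ?thesis
      using padic_abs_ultra[OF p, of "X m * (Y m - Y n)" "(X m - X n) * Y n"] a b
      by (simp add: algebra_simps)
  qed
  then show "\<exists>M. \<forall>m\<ge>M. \<forall>n\<ge>M. padic_abs p (X m * Y m - X n * Y n) < e" by blast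
qed

lemma padic_Cauchy_not_null:
  assumes "padic_Cauchy p X" "\<not> padic_null p X"
  obtains b M where "b > 0" "\<And>n. n \<ge> M \<Longrightarrow> padic_abs p (X n) > b"
proof -
  obtain L where L: "(\<lambda>n. padic_abs p (X n)) \<longlonglongrightarrow> L"
    using padic_Cauchy_convergent[OF assms(1)] by (auto simp: convergent_def)
  have "L \<ge> 0" using L by (rule LIMSEQ_le_const) (use padic_abs_nonneg[OF p] in auto)
  moreover have "L \<noteq> 0" using L assms(2) by (auto simp: padic_null_def)
  ultimately have "L > 0" by simp
  then have "eventually (\<lambda>n. padic_abs p (X n) > L / 2) sequentially"
    using L by (intro order_tendstoD) auto
  then show ?thesis using that[of "L / 2"] \<open>L > 0\<close> by (auto simp: eventually_sequentially)
qed

lemma padic_abs_inverse_diff: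
  assumes "padic_abs p x > a" "padic_abs p y > b" "a > 0" "b > 0"
  shows "padic_abs p (inverse x - inverse y) \<le> padic_abs p (x - y) / (a * b)"
proof -
  have nz: "x \<noteq> 0" "y \<noteq> 0" using assms by auto
  have "padic_abs p (inverse x - inverse y) = padic_abs p (- (inverse x * (x - y) * inverse y))"
    using nz by (simp only: inverse_diff_inverse not_False_eq_True)
  also have "\<dots> = padic_abs p (x - y) / (padic_abs p x * padic_abs p y)"
    by (simp only: padic_abs_minus[OF p] padic_abs_mult[OF p] padic_abs_inverse[OF p])
      (simp add: divide_inverse)
  also have "\<dots> \<le> padic_abs p (x - y) / (a * b)"
    using assms padic_abs_nonneg[OF p]
    by (intro divide_left_mono mult_mono mult_pos_pos) auto
  finally show ?thesis .
qed

lemma padic_Cauchy_inverse: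
  assumes "padic_Cauchy p X" "\<not> padic_null p X" shows "padic_Cauchy p (\<lambda>n. inverse (X n))"
  unfolding padic_Cauchy_def
proof (intro allI impI)
  fix e :: real assume e: "e > 0"
  obtain b M where b: "b > 0" "\<And>n. n \<ge> M \<Longrightarrow> padic_abs p (X n) > b"
    using padic_Cauchy_not_null[OF assms] by blast
  have "e * (b * b) > 0" using e b by simp
  then obtain M' where M': "\<And>m n. m \<ge> M' \<Longrightarrow> n \<ge> M' \<Longrightarrow> padic_abs p (X m - X n) < e * (b * b)"
    using assms(1) unfolding padic_Cauchy_def by blast
  have "padic_abs p (inverse (X m) - inverse (X n)) < e" if mn: "m \<ge> max M M'" "n \<ge> max M M'" for m n
  proof -
    have "padic_abs p (inverse (X m) - inverse (X n)) \<le> padic_abs p (X m - X n) / (b * b)"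
      using mn b by (intro padic_abs_inverse_diff) auto
    also have "\<dots> < e" using M'[of m n] mn b by (simp add: divide_less_eq)
    finally show ?thesis .
  qed
  then show "\<exists>M. \<forall>m\<ge>M. \<forall>n\<ge>M. padic_abs p (inverse (X m) - inverse (X n)) < e" by blast
qed

lemma padic_null_diff_inverse:
  assumes X: "padic_Cauchy p X" "\<not> padic_null p X" and Y: "padic_Cauchy p Y" "\<not> padic_null p Y"
    and XY: "padic_null p (\<lambda>n. X n - Y n)"
  shows "padic_null p (\<lambda>n. inverse (X n) - inverse (Y n))"
proof -
  obtain a M where a: "a > 0" "\<And>n. n \<ge> M \<Longrightarrow> padic_abs p (X n) > a"
    using padic_Cauchy_not_null[OF X] by blast
  obtain b M' where b: "b > 0" "\<And>n. n \<ge> M' \<Longrightarrow> padic_abs p (Y n) > b"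
    using padic_Cauchy_not_null[OF Y] by blast
  have lim: "(\<lambda>n. padic_abs p (X n - Y n) / (a * b)) \<longlonglongrightarrow> 0"
    using tendsto_divide[OF XY[unfolded padic_null_def] tendsto_const[of "a * b"]] a b by simp
  have "padic_abs p (inverse (X n) - inverse (Y n)) \<le> padic_abs p (X n - Y n) / (a * b)"
    if "n \<ge> max M M'" for n using a b that by (intro padic_abs_inverse_diff) auto
  then have "eventually (\<lambda>n. norm (padic_abs p (inverse (X n) - inverse (Y n)))
      \<le> padic_abs p (X n - Y n) / (a * b)) sequentially"
    using padic_abs_nonneg[OF p] unfolding eventually_sequentially
    by (metis abs_of_nonneg real_norm_def)
  then show ?thesis unfolding padic_null_def using lim by (rule real_null_comparison)
qed

lemma padic_rel_lim:
  assumes "padic_rel p X Y"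
  shows "lim (\<lambda>n. padic_abs p (X n)) = lim (\<lambda>n. padic_abs p (Y n))"
proof -
  obtain L where L: "(\<lambda>n. padic_abs p (Y n)) \<longlonglongrightarrow> L"
    using padic_Cauchy_convergent[of Y] assms by (auto simp: convergent_def padic_rel_def)
  have "(\<lambda>n. padic_abs p (X n) - padic_abs p (Y n)) \<longlonglongrightarrow> 0"
    by (rule real_null_comparison[of _ "\<lambda>n. padic_abs p (X n - Y n)"])
      (use assms padic_abs_diff[OF p] in \<open>auto simp: padic_rel_def padic_null_def\<close>)
  from tendsto_add[OF this L] have "(\<lambda>n. padic_abs p (X n)) \<longlonglongrightarrow> L" by simp
  then show ?thesis using L by (simp add: limI)
qed

lemma padic_rel_part_equivp: "part_equivp (padic_rel p)"
proof (rule part_equivpI)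
  show "\<exists>x. padic_rel p x x" by (rule exI[of _ "\<lambda>n. 0"]) (simp add: padic_rel_def)
  show "symp (padic_rel p)"
    using padic_null_minus by (fastforce simp: symp_def padic_rel_def)
  show "transp (padic_rel p)"
    using padic_null_add by (fastforce intro!: transpI simp: padic_rel_def)
qed

end

lemma prime_CARD: "prime CARD('p::prime_card)"
  by (rule prime_card)

typedef ('p::prime_card) padic =
  "{C. \<exists>X. padic_Cauchy CARD('p) X \<and> C = {Y. padic_rel CARD('p) X Y}}"
  by (rule exI[of _ "{Y. padic_rel CARD('p) (\<lambda>n. 0) Y}"])
    (auto intro!: exI[of _ "\<lambda>n. 0"] simp: prime_CARD)

definition Padic :: "(nat \<Rightarrow> rat) \<Rightarrow> 'p::prime_card padic" where
  "Padic X = Abs_padic {Y. padic_rel CARD('p) X Y}"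

definition padic_rep :: "'p::prime_card padic \<Rightarrow> nat \<Rightarrow> rat" where
  "padic_rep x = (SOME X. X \<in> Rep_padic x)"

definition cr_padic :: "(nat \<Rightarrow> rat) \<Rightarrow> 'p::prime_card padic \<Rightarrow> bool" where
  "cr_padic X x \<longleftrightarrow> padic_rel CARD('p) X X \<and> Padic X = x"

lemma Quotient_padic:
  "Quotient (padic_rel CARD('p)) Padic padic_rep (cr_padic :: _ \<Rightarrow> 'p::prime_card padic \<Rightarrow> bool)"
proof -
  let ?R = "padic_rel CARD('p)"
  have pe: "part_equivp ?R" by (rule padic_rel_part_equivp[OF prime_CARD])
  have sym: "?R X Y \<Longrightarrow> ?R Y X" for X Y
    using pe by (rule part_equivp_symp)
  have trans: "?R X Y \<Longrightarrow> ?R Y Z \<Longrightarrow> ?R X Z" for X Y Z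
    using pe by (rule part_equivp_transp)
  have refl: "?R X X \<longleftrightarrow> padic_Cauchy CARD('p) X" for X
    by (simp add: padic_rel_def prime_CARD)
  have Rep: "Rep_padic (Padic X :: 'p padic) = {Y. ?R X Y}" if "?R X X" for X
    unfolding Padic_def by (rule Abs_padic_inverse) (use that refl in blast)
  have rep: "?R (padic_rep a) (padic_rep a) \<and> Padic (padic_rep a) = a" for a :: "'p padic"
  proof -
    obtain X where X: "?R X X" "Rep_padic a = {Y. ?R X Y}"
      using Rep_padic[of a] refl by auto
    have "padic_rep a \<in> Rep_padic a"
      unfolding padic_rep_def by (rule someI[of "\<lambda>Z. Z \<in> Rep_padic a" X]) (simp add: X)
    then have *: "?R X (padic_rep a)" using X by simp
    then have "{Y. ?R (padic_rep a) Y} = {Y. ?R X Y}" using sym trans by blast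
    then have "Padic (padic_rep a) = a" unfolding Padic_def X(2)[symmetric] by (simp add: Rep_padic_inverse)
    then show ?thesis using * sym trans by blast
  qed
  have iff: "?R X Y \<longleftrightarrow> ?R X X \<and> ?R Y Y \<and> Padic X = (Padic Y :: 'p padic)" for X Y
  proof
    assume "?R X Y"
    then show "?R X X \<and> ?R Y Y \<and> Padic X = (Padic Y :: 'p padic)"
    proof (intro conjI)
      have "{Z. ?R X Z} = {Z. ?R Y Z}" using \<open>?R X Y\<close> by (blast intro: sym trans)
      then show "Padic X = (Padic Y :: 'p padic)" unfolding Padic_def by (rule arg_cong)
    qed (use \<open>?R X Y\<close> in \<open>blast intro: sym trans\<close>)+
  next
    assume *: "?R X X \<and> ?R Y Y \<and> Padic X = (Padic Y :: 'p padic)"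
    then have "{Z. ?R X Z} = {Z. ?R Y Z}" using Rep[of X] Rep[of Y] by simp
    then show "?R X Y" using * by blast
  qed
  show ?thesis
    unfolding Quotient_def
  proof (intro conjI allI)
    show "?R X Y \<longleftrightarrow> ?R X X \<and> ?R Y Y \<and> Padic X = (Padic Y :: 'p padic)" for X Y
      by (rule iff)
    show "cr_padic = (\<lambda>X x. ?R X X \<and> Padic X = (x :: 'p padic))"
      unfolding cr_padic_def ..
  qed (use rep in blast)+
qed

setup_lifting Quotient_padic

instantiation padic :: (prime_card) field
begin

lift_definition zero_padic :: "'a padic" is "\<lambda>n. 0"
  by (simp add: padic_rel_def prime_CARD)

lift_definition one_padic :: "'a padic" is "\<lambda>n. 1"
  by (simp add: padic_rel_def prime_CARD)

lift_definition plus_padic :: "'a padic \<Rightarrow> 'a padic \<Rightarrow> 'a padic" is "\<lambda>X Y n. X n + Y n"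
  unfolding padic_rel_def add_diff_add
  by (intro conjI; elim conjE; (rule padic_Cauchy_add[OF prime_CARD] padic_null_add[OF prime_CARD]; assumption))

lift_definition uminus_padic :: "'a padic \<Rightarrow> 'a padic" is "\<lambda>X n. - X n"
  unfolding padic_rel_def minus_diff_minus
  by (intro conjI; elim conjE; (rule padic_Cauchy_minus[OF prime_CARD] padic_null_minus[OF prime_CARD]; assumption))

lift_definition times_padic :: "'a padic \<Rightarrow> 'a padic \<Rightarrow> 'a padic" is "\<lambda>X Y n. X n * Y n"
proof -
  fix f1 f2 f3 f4
  assume "padic_rel CARD('a) f1 f2" "padic_rel CARD('a) f3 f4"
  then have *: "padic_Cauchy CARD('a) f1" "padic_Cauchy CARD('a) f4" "padic_Cauchy CARD('a) f2"
    "padic_Cauchy CARD('a) f3"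
    "padic_null CARD('a) (\<lambda>n. f1 n - f2 n)" "padic_null CARD('a) (\<lambda>n. f3 n - f4 n)"
    by (auto simp: padic_rel_def)
  then have "padic_null CARD('a) (\<lambda>n. f1 n * (f3 n - f4 n) + f4 n * (f1 n - f2 n))"
    by (intro padic_null_add[OF prime_CARD] padic_null_mult[OF prime_CARD])
  moreover have "f1 n * (f3 n - f4 n) + f4 n * (f1 n - f2 n) = f1 n * f3 n - f2 n * f4 n" for n
    by (simp add: algebra_simps)
  ultimately have "padic_null CARD('a) (\<lambda>n. f1 n * f3 n - f2 n * f4 n)" by (simp only:)
  then show "padic_rel CARD('a) (\<lambda>n. f1 n * f3 n) (\<lambda>n. f2 n * f4 n)"
    unfolding padic_rel_def by (intro conjI padic_Cauchy_mult[OF prime_CARD] *)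
qed

lift_definition inverse_padic :: "'a padic \<Rightarrow> 'a padic"
  is "\<lambda>X. if padic_null CARD('a) X then (\<lambda>n. 0) else (\<lambda>n. inverse (X n))"
proof -
  fix X Y
  assume *: "padic_rel CARD('a) X Y"
  then have X: "padic_Cauchy CARD('a) X" and Y: "padic_Cauchy CARD('a) Y"
    and XY: "padic_null CARD('a) (\<lambda>n. X n - Y n)" by (simp_all only: padic_rel_def)
  have iff: "padic_null CARD('a) X \<longleftrightarrow> padic_null CARD('a) Y"
  proof
    assume "padic_null CARD('a) X"
    from padic_null_diff[OF prime_CARD this XY] show "padic_null CARD('a) Y" by simp
  next
    assume "padic_null CARD('a) Y"
    from padic_null_add[OF prime_CARD this XY] show "padic_null CARD('a) X" by simp
  qed
  show "padic_rel CARD('a) (if padic_null CARD('a) X then (\<lambda>n. 0) else (\<lambda>n. inverse (X n)))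
      (if padic_null CARD('a) Y then (\<lambda>n. 0) else (\<lambda>n. inverse (Y n)))"
  proof (cases "padic_null CARD('a) X")
    case True
    then show ?thesis using iff by (simp add: padic_rel_def prime_CARD)
  next
    case False
    then have "\<not> padic_null CARD('a) Y" using iff by simp
    with False show ?thesis unfolding padic_rel_def
      using padic_Cauchy_inverse[OF prime_CARD X False] padic_Cauchy_inverse[OF prime_CARD Y]
        padic_null_diff_inverse[OF prime_CARD X False Y _ XY] by simp
  qed
qed

definition "x - y = x + - y" for x y :: "'a padic"

definition "x div y = x * inverse y" for x y :: "'a padic"

instance
proof
  fix a b c :: "'a padic"
  show "a + b = b + a"
    by transfer (simp add: ac_simps padic_rel_def prime_CARD padic_Cauchy_add[OF prime_CARD])
  show "(a + b) + c = a + (b + c)"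
    by transfer (simp add: ac_simps padic_rel_def prime_CARD padic_Cauchy_add[OF prime_CARD])
  show "0 + a = a"
    by transfer (simp add: padic_rel_def prime_CARD)
  show "- a + a = 0"
    by transfer (simp add: padic_rel_def prime_CARD)
  show "a - b = a + - b"
    by (rule minus_padic_def)
  show "(a * b) * c = a * (b * c)"
    by transfer (simp add: ac_simps padic_rel_def prime_CARD padic_Cauchy_mult[OF prime_CARD])
  show "a * b = b * a"
    by transfer (simp add: ac_simps padic_rel_def prime_CARD padic_Cauchy_mult[OF prime_CARD])
  show "1 * a = a"
    by transfer (simp add: padic_rel_def prime_CARD)
  show "(a + b) * c = a * c + b * c"
    by transfer (simp add: distrib_right padic_rel_def prime_CARD padic_Cauchy_mult[OF prime_CARD] padic_Cauchy_add[OF prime_CARD])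
  show "(0::'a padic) \<noteq> 1"
    by transfer (simp add: padic_rel_def prime_CARD)
  have "padic_null CARD('a) (\<lambda>n. inverse (X n) * X n - 1)"
    if X: "padic_Cauchy CARD('a) X" "\<not> padic_null CARD('a) X" for X
  proof -
    obtain b M where "b > 0" "\<And>n. n \<ge> M \<Longrightarrow> padic_abs CARD('a) (X n) > b"
      using padic_Cauchy_not_null[OF prime_CARD X] by blast
    then have "X n \<noteq> 0" if "n \<ge> M" for n using that by fastforce
    then have "padic_abs CARD('a) (inverse (X n) * X n - 1) = 0" if "n \<ge> M" for n
      using that by simp
    then have "eventually (\<lambda>n. padic_abs CARD('a) (inverse (X n) * X n - 1) = 0) sequentially"
      unfolding eventually_sequentially by blast
    then show ?thesis by (simp add: padic_null_def tendsto_eventually)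
  qed
  then show "a \<noteq> 0 \<Longrightarrow> inverse a * a = 1"
    by transfer (auto simp: padic_rel_def prime_CARD padic_Cauchy_mult[OF prime_CARD] padic_Cauchy_inverse[OF prime_CARD])
  show "a div b = a * inverse b"
    by (rule divide_padic_def)
  show "inverse (0::'a padic) = 0"
    by transfer (simp add: padic_rel_def prime_CARD)
qed

end

lemma Padic_cases:
  obtains X where "padic_Cauchy CARD('p::prime_card) X" "(x :: 'p padic) = Padic X"
proof (induct x)
  case (1 X)
  then show ?case by (auto simp: padic_rel_def)
qed

lemma Padic_eq_iff:
  assumes "padic_Cauchy CARD('p::prime_card) X" "padic_Cauchy CARD('p) Y"
  shows "(Padic X :: 'p padic) = Padic Y \<longleftrightarrow> padic_null CARD('p) (\<lambda>n. X n - Y n)"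
proof -
  have "padic_rel CARD('p) X X" "padic_rel CARD('p) Y Y"
    using assms by (simp_all add: padic_rel_def prime_CARD)
  then have "(Padic X :: 'p padic) = Padic Y \<longleftrightarrow> padic_rel CARD('p) X Y"
    using Quotient_rel[OF Quotient_padic, of X Y] by blast
  then show ?thesis using assms by (simp add: padic_rel_def)
qed

text \<open>The \<open>p\<close>-adic absolute value on the completion. It is a constant of its own because the
  overloaded \<open>norm\<close> is reserved for real normed vector spaces.\<close>

lift_definition padic_norm :: "'a::prime_card padic \<Rightarrow> real" is "\<lambda>X. lim (\<lambda>n. padic_abs CARD('a) (X n))"
  by (rule padic_rel_lim[OF prime_CARD])

lemma norm_Padic_tendsto:
  assumes "padic_Cauchy CARD('a::prime_card) X"
  shows "(\<lambda>n. padic_abs CARD('a) (X n)) \<longlonglongrightarrow> padic_norm (Padic X :: 'a padic)"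
proof -
  have "padic_norm (Padic X :: 'a padic) = lim (\<lambda>n. padic_abs CARD('a) (X n))"
    using assms by (intro padic_norm.abs_eq) (simp add: padic_rel_def prime_CARD)
  then show ?thesis using padic_Cauchy_convergent[OF prime_CARD assms] by (simp add: convergent_LIMSEQ_iff)
qed

lemma plus_Padic:
  "padic_Cauchy CARD('a::prime_card) X \<Longrightarrow> padic_Cauchy CARD('a) Y \<Longrightarrow>
    (Padic X :: 'a padic) + Padic Y = Padic (\<lambda>n. X n + Y n)"
  by (rule plus_padic.abs_eq) (simp_all add: padic_rel_def prime_CARD)

lemma times_Padic:
  "padic_Cauchy CARD('a::prime_card) X \<Longrightarrow> padic_Cauchy CARD('a) Y \<Longrightarrow>
    (Padic X :: 'a padic) * Padic Y = Padic (\<lambda>n. X n * Y n)"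
  by (rule times_padic.abs_eq) (simp_all add: padic_rel_def prime_CARD)

lemma uminus_Padic:
  "padic_Cauchy CARD('a::prime_card) X \<Longrightarrow> - (Padic X :: 'a padic) = Padic (\<lambda>n. - X n)"
  by (rule uminus_padic.abs_eq) (simp_all add: padic_rel_def prime_CARD)

lemma minus_Padic:
  "padic_Cauchy CARD('a::prime_card) X \<Longrightarrow> padic_Cauchy CARD('a) Y \<Longrightarrow>
    (Padic X :: 'a padic) - Padic Y = Padic (\<lambda>n. X n - Y n)"
  unfolding minus_padic_def by (subst uminus_Padic, assumption, subst plus_Padic)
    (simp_all add: padic_Cauchy_minus[OF prime_CARD])

lemma padic_norm_zero [simp]: "padic_norm (0 :: 'a::prime_card padic) = 0"
  by transfer (simp add: limI)

lemma padic_norm_one [simp]: "padic_norm (1 :: 'a::prime_card padic) = 1"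
  by transfer (simp add: limI padic_abs_1[OF prime_CARD])

lemma padic_norm_nonneg [simp]: "padic_norm (x :: 'a::prime_card padic) \<ge> 0"
proof -
  obtain X where X: "padic_Cauchy CARD('a) X" "x = Padic X" using Padic_cases .
  show ?thesis using norm_Padic_tendsto[OF X(1)] unfolding X(2)
    by (rule LIMSEQ_le_const) (auto simp: padic_abs_nonneg[OF prime_CARD])
qed

lemma padic_norm_eq_zero [simp]: "padic_norm (x :: 'a::prime_card padic) = 0 \<longleftrightarrow> x = 0"
proof
  obtain X where X: "padic_Cauchy CARD('a) X" "x = Padic X" using Padic_cases .
  assume "padic_norm x = 0"
  then have "padic_null CARD('a) X"
    using norm_Padic_tendsto[OF X(1)] X(2) by (simp add: padic_null_def)
  then have "Padic X = (Padic (\<lambda>n. 0) :: 'a padic)" using X(1) by (simp add: Padic_eq_iff prime_CARD)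
  then show "x = 0" unfolding X(2) zero_padic_def .
qed simp

lemma padic_norm_mult: "padic_norm (x * y :: 'a::prime_card padic) = padic_norm x * padic_norm y"
proof -
  obtain X where X: "padic_Cauchy CARD('a) X" "x = Padic X" using Padic_cases .
  obtain Y where Y: "padic_Cauchy CARD('a) Y" "y = Padic Y" using Padic_cases .
  have "(\<lambda>n. padic_abs CARD('a) (X n) * padic_abs CARD('a) (Y n)) \<longlonglongrightarrow> padic_norm x * padic_norm y"
    unfolding X(2) Y(2) by (intro tendsto_mult norm_Padic_tendsto X Y)
  moreover have "(\<lambda>n. padic_abs CARD('a) (X n) * padic_abs CARD('a) (Y n)) \<longlonglongrightarrow> padic_norm (x * y)"
    using norm_Padic_tendsto[OF padic_Cauchy_mult[OF prime_CARD X(1) Y(1)]] X Y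
    by (simp add: times_Padic padic_abs_mult[OF prime_CARD])
  ultimately show ?thesis by (rule LIMSEQ_unique[symmetric])
qed

lemma padic_norm_minus [simp]: "padic_norm (- x :: 'a::prime_card padic) = padic_norm x"
proof -
  have "padic_norm (- 1 :: 'a padic) * padic_norm (- 1 :: 'a padic) = 1"
    by (simp flip: padic_norm_mult)
  then have "padic_norm (- 1 :: 'a padic) = 1"
    using padic_norm_nonneg[of "- 1 :: 'a padic"] unfolding square_eq_1_iff by linarith
  then show ?thesis using padic_norm_mult[of "- 1" x] by (simp only: mult_minus1 mult_1)
qed

lemma padic_norm_ultra: "padic_norm (x + y :: 'a::prime_card padic) \<le> max (padic_norm x) (padic_norm y)"
proof -
  obtain X where X: "padic_Cauchy CARD('a) X" "x = Padic X" using Padic_cases .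
  obtain Y where Y: "padic_Cauchy CARD('a) Y" "y = Padic Y" using Padic_cases .
  have 1: "(\<lambda>n. max (padic_abs CARD('a) (X n)) (padic_abs CARD('a) (Y n))) \<longlonglongrightarrow> max (padic_norm x) (padic_norm y)"
    unfolding X(2) Y(2) by (intro tendsto_max norm_Padic_tendsto X Y)
  have 2: "(\<lambda>n. padic_abs CARD('a) (X n + Y n)) \<longlonglongrightarrow> padic_norm (x + y)"
    using norm_Padic_tendsto[OF padic_Cauchy_add[OF prime_CARD X(1) Y(1)]] X Y by (simp add: plus_Padic)
  show ?thesis by (rule LIMSEQ_le[OF 2 1]) (use padic_abs_ultra[OF prime_CARD] in blast)
qed

lemma padic_norm_triangle: "padic_norm (x + y :: 'a::prime_card padic) \<le> padic_norm x + padic_norm y"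
  using padic_norm_ultra[of x y] padic_norm_nonneg[of x] padic_norm_nonneg[of y] by linarith

instantiation padic :: (prime_card) metric_space
begin

definition "dist x y = padic_norm (x - y)" for x y :: "'a padic"

definition [code del]: "(uniformity :: ('a padic \<times> 'a padic) filter) =
  (INF e\<in>{0 <..}. principal {(x, y). dist x y < e})"

definition [code del]: "open (U :: 'a padic set) \<longleftrightarrow> (\<forall>x\<in>U. eventually (\<lambda>(x', y). x' = x \<longrightarrow> y \<in> U) uniformity)"

instance
proof
  fix x y z :: "'a padic"
  show "dist x y = 0 \<longleftrightarrow> x = y" by (simp add: dist_padic_def)
  show "dist x y \<le> dist x z + dist y z"
    using padic_norm_triangle[of "x - z" "z - y"] padic_norm_minus[of "z - y"]
    by (simp add: dist_padic_def)
qed (simp_all add: uniformity_padic_def open_padic_def)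

end

lemma of_nat_Padic: "of_nat k = (Padic (\<lambda>n. of_nat k) :: 'p::prime_card padic)"
  by (induction k) (simp_all add: zero_padic_def one_padic_def plus_Padic prime_CARD flip: map_fun_def)

instance padic :: (prime_card) field_char_0
proof
  show "inj (of_nat :: nat \<Rightarrow> 'a padic)"
  proof (rule injI)
    fix m n assume "of_nat m = (of_nat n :: 'a padic)"
    then have "padic_null CARD('a) (\<lambda>_. of_nat m - of_nat n)"
      by (simp add: of_nat_Padic Padic_eq_iff prime_CARD)
    then show "m = n" by (simp add: prime_CARD)
  qed
qed

lemma of_int_Padic: "of_int k = (Padic (\<lambda>n. of_int k) :: 'p::prime_card padic)"
  by (cases k rule: int_diff_cases) (simp add: of_nat_Padic minus_Padic prime_CARD)

lemma of_rat_Padic: "of_rat r = (Padic (\<lambda>n. r) :: 'p::prime_card padic)"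
proof (induction r)
  case (Fract a b)
  have "Padic (\<lambda>n. Rat.Fract a b) * (of_int b :: 'p padic) = of_int a"
    using Fract by (simp add: of_int_Padic times_Padic prime_CARD Fract_of_int_quotient)
  then show ?case using Fract by (simp add: of_rat_rat field_simps)
qed

text \<open>The next facts confirm that this is the completion of the rationals: the norm extends
  the \<open>p\<close>-adic absolute value, the rationals are dense, the metric is complete.
  The last instance guarantees that limits at a punctured point are unique.\<close>

lemma norm_of_rat_padic: "padic_norm (of_rat r :: 'p::prime_card padic) = padic_abs CARD('p) r"
  using norm_Padic_tendsto[OF padic_Cauchy_const[OF prime_CARD[where 'p='p]], of r] 
  by (simp add: of_rat_Padic LIMSEQ_const_iff)

lemma padic_approx_tail:
  assumes X: "padic_Cauchy CARD('p::prime_card) X" and "e > 0"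
  shows "eventually (\<lambda>n. dist (of_rat (X n)) (Padic X :: 'p padic) < e) sequentially"
proof -
  obtain M where M: "\<And>m n. m \<ge> M \<Longrightarrow> n \<ge> M \<Longrightarrow> padic_abs CARD('p) (X m - X n) < e / 2"
    using X \<open>e > 0\<close> unfolding padic_Cauchy_def by (meson half_gt_zero)
  have "dist (of_rat (X n)) (Padic X :: 'p padic) < e" if n: "n \<ge> M" for n
  proof -
    have "(\<lambda>m. padic_abs CARD('p) (X n - X m)) \<longlonglongrightarrow> padic_norm (Padic (\<lambda>m. X n - X m) :: 'p padic)"
      by (intro norm_Padic_tendsto padic_Cauchy_diff[OF prime_CARD] padic_Cauchy_const[OF prime_CARD] X)
    then have "padic_norm (Padic (\<lambda>m. X n - X m) :: 'p padic) \<le> e / 2"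
      by (rule LIMSEQ_le_const2) (use M n in \<open>auto intro!: exI[of _ M] less_imp_le\<close>)
    then show ?thesis using X \<open>e > 0\<close> by (simp add: dist_padic_def of_rat_Padic minus_Padic prime_CARD)
  qed
  then show ?thesis by (auto simp: eventually_sequentially)
qed

lemma padic_rat_dense:
  fixes x :: "'p::prime_card padic"
  assumes "e > 0" obtains r where "dist (of_rat r) x < e"
proof -
  obtain X where X: "padic_Cauchy CARD('p) X" "x = Padic X" using Padic_cases .
  show ?thesis using padic_approx_tail[OF X(1) assms] that X(2)
    by (auto simp: eventually_sequentially)
qed

instance padic :: (prime_card) complete_space
proof
  fix X :: "nat \<Rightarrow> 'a padic" assume X: "Cauchy X"
  have "\<exists>r. dist (of_rat r) (X n) < inverse (Suc n)" for n
    using padic_rat_dense[of "inverse (Suc n)" "X n"] by auto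
  then obtain r where r: "\<And>n. dist (of_rat (r n)) (X n) < inverse (Suc n)" by metis
  have small: "eventually (\<lambda>n. dist (of_rat (r n)) (X n) < e) sequentially" if e: "e > 0" for e
  proof -
    obtain M where M: "inverse (Suc M) < e" using reals_Archimedean[OF e] by auto
    have "dist (of_rat (r n)) (X n) < e" if "n \<ge> M" for n
    proof -
      have "inverse (real (Suc n)) \<le> inverse (real (Suc M))" using that by (intro le_imp_inverse_le) auto
      then show ?thesis using r[of n] M by linarith
    qed
    then show ?thesis by (auto simp: eventually_sequentially)
  qed
  have cr: "padic_Cauchy CARD('a) r" unfolding padic_Cauchy_def
  proof (intro allI impI)
    fix e :: real assume e: "e > 0"
    obtain M1 where M1: "\<And>m n. m \<ge> M1 \<Longrightarrow> n \<ge> M1 \<Longrightarrow> dist (X m) (X n) < e / 3"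
      using X e unfolding Cauchy_def by (metis divide_pos_pos zero_less_numeral)
    obtain M2 where M2: "\<And>n. n \<ge> M2 \<Longrightarrow> dist (of_rat (r n)) (X n) < e / 3"
      using small[of "e / 3"] e by (auto simp: eventually_sequentially)
    have "padic_abs CARD('a) (r m - r n) < e" if "m \<ge> max M1 M2" "n \<ge> max M1 M2" for m n
    proof -
      have "dist (of_rat (r m)) (of_rat (r n) :: 'a padic) < e"
        using M1[of m n] M2[of m] M2[of n] that
          dist_triangle[of "of_rat (r m)" "of_rat (r n) :: 'a padic" "X m"]
          dist_triangle[of "X m" "of_rat (r n)" "X n"] dist_commute[of "X n" "of_rat (r n)"]
        by (simp del: dist_commute)
      then show ?thesis by (simp add: dist_padic_def norm_of_rat_padic flip: of_rat_diff)
    qed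
    then show "\<exists>M. \<forall>m\<ge>M. \<forall>n\<ge>M. padic_abs CARD('a) (r m - r n) < e" by blast
  qed
  have "X \<longlonglongrightarrow> Padic r"
  proof (rule tendstoI)
    fix e :: real assume "e > 0"
    then have "eventually (\<lambda>n. dist (of_rat (r n)) (X n) < e / 2) sequentially"
      "eventually (\<lambda>n. dist (of_rat (r n)) (Padic r :: 'a padic) < e / 2) sequentially"
      by (simp_all only: small half_gt_zero padic_approx_tail[OF cr])
    then show "eventually (\<lambda>n. dist (X n) (Padic r) < e) sequentially"
      by eventually_elim (metis dist_triangle_half_r)
  qed
  then show "convergent X" by (auto simp: convergent_def)
qed

instance padic :: (prime_card) perfect_space
proof
  fix x :: "'a padic"
  show "\<not> open {x}"
  proof
    assume "open {x}"
    then obtain e where e: "e > 0" "\<And>y. dist y x < e \<Longrightarrow> y = x"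
      by (auto simp: open_dist)
    have "padic_norm (of_rat (of_nat CARD('a)) :: 'a padic) = 1 / real CARD('a)"
      by (simp only: norm_of_rat_padic padic_abs_prime[OF prime_CARD])
    then have n: "padic_norm (of_nat CARD('a) ^ k :: 'a padic) = (1 / real CARD('a)) ^ k" for k
      by (induction k) (simp_all add: padic_norm_mult)
    have "1 / real CARD('a) < 1" using p_gt_1[OF prime_CARD[where 'p='a]] by simp
    from real_arch_pow_inv[OF e(1) this] obtain k where "(1 / real CARD('a)) ^ k < e" ..
    then have "dist (x + of_nat CARD('a) ^ k) x < e" by (simp add: dist_padic_def n)
    then have "x + of_nat CARD('a) ^ k = x" by (rule e(2))
    then show False by simp
  qed
qed


section \<open>Fixed points of \<open>p\<close>-adic dynamical systems\<close>

text \<open>The library's \<open>has_field_derivative\<close> requires a real normed field,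
  so the derivative is stated as the limit of difference quotients.\<close>

definition has_padic_derivative ::
    "('p::prime_card padic \<Rightarrow> 'p padic) \<Rightarrow> 'p padic \<Rightarrow> 'p padic \<Rightarrow> bool" where
  "has_padic_derivative f l x \<longleftrightarrow> ((\<lambda>h. (f (x + h) - f x) / h) \<longlongrightarrow> l) (at 0)"

definition attractive :: "('p::prime_card padic \<Rightarrow> 'p padic) \<Rightarrow> 'p padic \<Rightarrow> bool" where
  "attractive f x \<longleftrightarrow> f x = x \<and> (\<exists>l. has_padic_derivative f l x \<and> padic_norm l < 1)"

definition neutral :: "('p::prime_card padic \<Rightarrow> 'p padic) \<Rightarrow> 'p padic \<Rightarrow> bool" where
  "neutral f x \<longleftrightarrow> f x = x \<and> (\<exists>l. has_padic_derivative f l x \<and> padic_norm l = 1)"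

definition repelling :: "('p::prime_card padic \<Rightarrow> 'p padic) \<Rightarrow> 'p padic \<Rightarrow> bool" where
  "repelling f x \<longleftrightarrow> f x = x \<and> (\<exists>l. has_padic_derivative f l x \<and> padic_norm l > 1)"

text \<open>At the pole \<open>x = 1 - \<theta> - q\<close> division by zero makes the value \<open>0\<close>.
  This creates no spurious fixed point as long as \<open>\<theta> + q \<noteq> 1\<close>.\<close>

definition potts_map :: "'p::prime_card padic \<Rightarrow> 'p padic \<Rightarrow> 'p padic \<Rightarrow> 'p padic" where
  "potts_map \<theta> q x = ((\<theta> * x + q) / (x + \<theta> + q - 1)) ^ 2"

end

theory Submission
  imports Defs
begin

text \<open>Write \<open>f = g\<^sup>2\<close> with \<open>g x = (\<theta> x + q) / D\<close> and \<open>D = x + \<theta> + q - 1\<close>. Then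
  \<open>f' x = 2 (\<theta> - 1) (\<theta> + q) (\<theta> x + q) / D\<^sup>3\<close>, and a fixed point satisfies
  \<open>\<bar>D\<bar>\<^sup>2 \<bar>x\<bar> = \<bar>\<theta> x + q\<bar>\<^sup>2\<close>. Since \<open>\<bar>\<theta> x\<bar> < \<bar>q\<bar>\<close> in all cases, \<open>\<bar>D\<bar>\<close> and hence
  \<open>\<bar>f' x\<bar>\<close> are determined by \<open>\<bar>x\<bar>\<close> and \<open>\<bar>q\<bar>\<close>.\<close>

section \<open>Arithmetic of the norm and the strict ultrametric inequality\<close>

lemma padic_norm_power: "padic_norm (x ^ n :: 'p::prime_card padic) = padic_norm x ^ n"
  by (induction n) (simp_all add: padic_norm_mult)

lemma padic_norm_divide: "padic_norm (x / y :: 'p::prime_card padic) = padic_norm x / padic_norm y"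
proof (cases "y = 0")
  case False
  then have "padic_norm (x / y) * padic_norm y = padic_norm x"
    by (simp flip: padic_norm_mult)
  then show ?thesis using False by (simp add: field_simps)
qed simp

text \<open>Writing x as (x + y) - y gives |x| \<le> max |x + y| |y|. As |y| < |x|, this forces |x|
  \<le> |x + y|; the other bound is the ultrametric inequality itself.\<close>

lemma padic_norm_add_eq:
  fixes x y :: "'p::prime_card padic"
  assumes "padic_norm y < padic_norm x"
  shows "padic_norm (x + y) = padic_norm x"
  using padic_norm_ultra[of x y] padic_norm_ultra[of "x + y" "- y"] assms by simp

lemma padic_norm_of_nat: "padic_norm (of_nat n :: 'p::prime_card padic) = padic_abs CARD('p) (of_nat n)"
  using norm_of_rat_padic[where 'p='p, of "of_nat n"] by simp

lemma padic_norm_of_nat_le_1: "padic_norm (of_nat n :: 'p::prime_card padic) \<le> 1"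
proof (induction n)
  case (Suc n)
  then show ?case using padic_norm_ultra[of "of_nat n :: 'p padic" 1] by (simp add: add.commute)
qed simp

lemma padic_norm_of_int_le_1: "padic_norm (of_int k :: 'p::prime_card padic) \<le> 1"
  by (cases k) (simp_all add: padic_norm_of_nat_le_1 del: of_nat_Suc)

lemma padic_norm_CARD: "padic_norm (of_nat CARD('p) :: 'p::prime_card padic) = 1 / CARD('p)"
  by (simp only: padic_norm_of_nat padic_abs_prime[OF prime_CARD])

text \<open>The prime is odd, say 2 k + 1, so 2 k = -1 + \<open>CARD('p)\<close> has norm 1. Both
  factors 2 and k are integers of norm at most 1, so neither norm can drop below 1.\<close>

lemma padic_norm_two:
  assumes "CARD('p::prime_card) \<ge> 3"
  shows "padic_norm (2 :: 'p padic) = 1"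
proof -
  have "odd CARD('p)"
    using prime_odd_nat[OF prime_CARD[where 'p='p]] assms by simp
  then obtain k where k: "CARD('p) = 2 * k + 1" by (rule oddE)
  have eq: "(2 :: 'p padic) * of_nat k = - 1 + of_nat CARD('p)"
    by (simp add: k)
  have "padic_norm (- 1 + of_nat CARD('p) :: 'p padic) = 1"
    using padic_norm_add_eq[of "of_nat CARD('p)" "- 1 :: 'p padic"] padic_norm_CARD[where 'p='p] assms
    by simp
  then have "padic_norm (2 :: 'p padic) * padic_norm (of_nat k :: 'p padic) = 1"
    unfolding padic_norm_mult[symmetric] eq .
  moreover have "padic_norm (2 :: 'p padic) \<le> 1"
    using padic_norm_of_nat_le_1[where 'p='p, of 2] by simp
  moreover have "padic_norm (2 :: 'p padic) * padic_norm (of_nat k :: 'p padic) \<le> padic_norm (2 :: 'p padic)"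
    by (rule mult_left_le) (simp_all add: padic_norm_of_nat_le_1)
  ultimately show ?thesis by linarith
qed

section \<open>The derivative of the Potts map\<close>

text \<open>Reduces differentiability to an error estimate linear in |h| on a punctured ball, which
  an algebraic identity can supply.\<close>

lemma has_padic_derivativeI:
  fixes f :: "'p::prime_card padic \<Rightarrow> 'p padic"
  assumes "d > 0"
    and bound: "\<And>h. h \<noteq> 0 \<Longrightarrow> padic_norm h < d \<Longrightarrow>
      padic_norm ((f (x + h) - f x) / h - l) \<le> C * padic_norm h"
  shows "has_padic_derivative f l x"
  unfolding has_padic_derivative_def
proof (rule tendstoI)
  fix e :: real assume "e > 0"
  \<comment> \<open>The sign of \<open>C\<close> is not prescribed, so |C| + 1 serves as a positive
    divisor.\<close>
  define r where "r = min d (e / (\<bar>C\<bar> + 1))"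
  have "r > 0" using \<open>e > 0\<close> \<open>d > 0\<close> by (simp add: r_def)
  moreover have "dist ((f (x + h) - f x) / h) l < e" if "h \<noteq> 0" "dist h 0 < r" for h
  proof -
    have h: "padic_norm h < d" "padic_norm h < e / (\<bar>C\<bar> + 1)"
      using that by (simp_all add: r_def dist_padic_def)
    have "C * padic_norm h \<le> (\<bar>C\<bar> + 1) * padic_norm h"
      by (intro mult_right_mono) auto
    also have "\<dots> < e" using h(2) by (simp add: field_simps)
    finally show ?thesis using bound[OF that(1) h(1)] by (simp add: dist_padic_def)
  qed
  ultimately show "eventually (\<lambda>h. dist ((f (x + h) - f x) / h) l < e) (at 0)"
    unfolding eventually_at by blast
qed

lemma potts_map_derivative:
  fixes \<theta> q x :: "'p::prime_card padic"
  assumes "x + \<theta> + q - 1 \<noteq> 0"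
  shows "has_padic_derivative (potts_map \<theta> q)
    (2 * (\<theta> - 1) * (\<theta> + q) * (\<theta> * x + q) / (x + \<theta> + q - 1) ^ 3) x"
proof -
  define A where "A = \<theta> * x + q"
  define D where "D = x + \<theta> + q - 1"
  \<comment> \<open>\<open>B / D ^ 2\<close> is the derivative of the fractional linear map whose
    square is \<open>potts_map\<close>.\<close>
  define B where "B = \<theta> * D - A"
  \<comment> \<open>\<open>E - 2 * A * h\<close> will be the cofactor of \<open>B * h\<close> in the
    numerator of the error; \<open>K\<close> bounds its norm for |h| < |D|.\<close>
  define E where "E = D * (\<theta> * D + A) - 4 * A * D"
  define K where "K = padic_norm E + padic_norm (2 * A) * padic_norm D"
  have "D \<noteq> 0" using assms by (simp add: D_def)
  then have "padic_norm D > 0" using padic_norm_nonneg[of D] by (simp add: less_le)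
  have B: "(\<theta> - 1) * (\<theta> + q) = B" by (simp add: B_def A_def D_def algebra_simps)
  have "has_padic_derivative (potts_map \<theta> q) (2 * B * A / D ^ 3) x"
  \<comment> \<open>The radius |D| keeps x + h off the pole and makes |D + h| constant, so the
    denominator of the error has fixed norm.\<close>
  proof (rule has_padic_derivativeI[OF \<open>padic_norm D > 0\<close>])
    fix h :: "'p padic" assume h: "h \<noteq> 0" "padic_norm h < padic_norm D"
    have Dh: "padic_norm (D + h) = padic_norm D" using h(2) by (rule padic_norm_add_eq)
    then have nz: "D + h \<noteq> 0" using \<open>padic_norm D > 0\<close> by auto
    have f: "potts_map \<theta> q (x + h) = ((A + \<theta> * h) / (D + h)) ^ 2" "potts_map \<theta> q x = (A / D) ^ 2"
      by (simp_all add: potts_map_def A_def D_def algebra_simps)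
    define u where "u = D + h"
    define G where "G = 2 * A * D + (\<theta> * D + A) * h"
    have "u \<noteq> 0" using nz by (simp add: u_def)
    have "potts_map \<theta> q (x + h) - potts_map \<theta> q x
        = ((A + \<theta> * h) ^ 2 * D ^ 2 - A ^ 2 * u ^ 2) / (u ^ 2 * D ^ 2)"
      unfolding f u_def[symmetric] power_divide using \<open>u \<noteq> 0\<close> \<open>D \<noteq> 0\<close> by (simp add: diff_frac_eq)
    \<comment> \<open>A difference of squares: the difference of the bases is \<open>h * B\<close>,
      their sum is \<open>G\<close>.\<close>
    also have "(A + \<theta> * h) ^ 2 * D ^ 2 - A ^ 2 * u ^ 2 = h * (B * G)"
      unfolding B_def G_def u_def by (simp add: algebra_simps power2_eq_square)
    finally have "(potts_map \<theta> q (x + h) - potts_map \<theta> q x) / h = B * G / (u ^ 2 * D ^ 2)"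
      using h(1) by simp
    also have "\<dots> = B * G * D / (D ^ 3 * u ^ 2)"
      using \<open>D \<noteq> 0\<close> by (simp add: power3_eq_cube power2_eq_square)
    also have "\<dots> - 2 * B * A / D ^ 3 = (B * G * D - 2 * B * A * u ^ 2) / (D ^ 3 * u ^ 2)"
      using \<open>u \<noteq> 0\<close> by (simp add: diff_divide_distrib)
    \<comment> \<open>Both products have the same term 2 B A D^2 free of h, so a factor h splits
      off.\<close>
    also have "B * G * D - 2 * B * A * u ^ 2 = B * h * (E + - (2 * A * h))"
      unfolding G_def u_def E_def by (simp add: algebra_simps power2_eq_square)
    finally have "(potts_map \<theta> q (x + h) - potts_map \<theta> q x) / h - 2 * B * A / D ^ 3
        = B * h * (E + - (2 * A * h)) / (D ^ 3 * (D + h) ^ 2)"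
      unfolding u_def .
    then have "padic_norm ((potts_map \<theta> q (x + h) - potts_map \<theta> q x) / h - 2 * B * A / D ^ 3)
        = padic_norm B * padic_norm h * padic_norm (E + - (2 * A * h)) / padic_norm D ^ 5"
      by (simp add: padic_norm_divide padic_norm_mult padic_norm_power Dh flip: power_add)
    also have "\<dots> \<le> padic_norm B * padic_norm h * K / padic_norm D ^ 5"
    proof -
      have "padic_norm (2 * A * h) \<le> padic_norm (2 * A) * padic_norm D"
        using h(2) by (simp add: padic_norm_mult mult_left_mono)
      then have "padic_norm (E + - (2 * A * h)) \<le> K"
        using padic_norm_triangle[of E "- (2 * A * h)"] by (simp add: K_def)
      then show ?thesis by (intro divide_right_mono mult_left_mono) auto
    qed
    finally show "padic_norm ((potts_map \<theta> q (x + h) - potts_map \<theta> q x) / h - 2 * B * A / D ^ 3)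
        \<le> (padic_norm B * K / padic_norm D ^ 5) * padic_norm h"
      by (simp add: mult_ac)
  qed
  then show ?thesis unfolding A_def D_def B[symmetric] by (simp only: mult.assoc)
qed

section \<open>Fixed points and their multipliers\<close>

text \<open>Clearing denominators in f(x) = x gives a cubic that splits into x - 1 and the
  quadratic. Its roots avoid the pole, so the default value of division by zero does not
  enter.\<close>

lemma potts_map_fixed_point:
  fixes \<theta> q x :: "'p::prime_card padic"
  assumes x: "x = 1 \<or> x ^ 2 + (2 * \<theta> - \<theta> ^ 2 + 2 * q - 1) * x + q ^ 2 = 0"
    and "\<theta> \<noteq> 1" "\<theta> + q \<noteq> 0"
  shows "x + \<theta> + q - 1 \<noteq> 0"
    and "(x + \<theta> + q - 1) ^ 2 * x = (\<theta> * x + q) ^ 2"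
    and "potts_map \<theta> q x = x"
proof -
  have "(x + \<theta> + q - 1) ^ 2 * x - (\<theta> * x + q) ^ 2
      = (x - 1) * (x ^ 2 + (2 * \<theta> - \<theta> ^ 2 + 2 * q - 1) * x + q ^ 2)"
    by (simp add: algebra_simps power2_eq_square)
  then show eq: "(x + \<theta> + q - 1) ^ 2 * x = (\<theta> * x + q) ^ 2" using x by auto
  show nz: "x + \<theta> + q - 1 \<noteq> 0"
  proof
    assume D: "x + \<theta> + q - 1 = 0"
    then have "\<theta> * x + q = 0" using eq by simp
    \<comment> \<open>This combination of numerator and denominator is a nonzero constant, so the
      two cannot vanish together.\<close>
    moreover have "(\<theta> - 1) * (\<theta> + q) = \<theta> * (x + \<theta> + q - 1) - (\<theta> * x + q)"
      by (simp add: algebra_simps)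
    ultimately have "(\<theta> - 1) * (\<theta> + q) = 0" using D by simp
    then show False using assms by simp
  qed
  show "potts_map \<theta> q x = x"
    using nz eq by (simp add: potts_map_def power_divide divide_eq_eq mult.commute)
qed

text \<open>The factors 2 and \<theta> - 1 of the derivative have norm 1 and disappear. The last
  conclusion is the fixed point equation in norms, from which |D| is computed later.\<close>

lemma potts_map_multiplier:
  fixes \<theta> q x :: "'p::prime_card padic"
  assumes "CARD('p) \<ge> 3" and "padic_norm \<theta> < 1" and "\<theta> + q \<noteq> 0"
    and x: "x = 1 \<or> x ^ 2 + (2 * \<theta> - \<theta> ^ 2 + 2 * q - 1) * x + q ^ 2 = 0"
  obtains l where "has_padic_derivative (potts_map \<theta> q) l x"
    and "padic_norm l = padic_norm (\<theta> + q) * padic_norm (\<theta> * x + q) / padic_norm (x + \<theta> + q - 1) ^ 3"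
    and "potts_map \<theta> q x = x" and "x + \<theta> + q - 1 \<noteq> 0"
    and "padic_norm (x + \<theta> + q - 1) ^ 2 * padic_norm x = padic_norm (\<theta> * x + q) ^ 2"
proof -
  have "\<theta> \<noteq> 1" using assms(2) by auto
  note fp = potts_map_fixed_point[OF x this assms(3)]
  have "padic_norm (\<theta> - 1) = 1"
    using padic_norm_add_eq[of \<theta> "- 1"] assms(2) by simp
  then have "padic_norm (2 * (\<theta> - 1) * (\<theta> + q) * (\<theta> * x + q) / (x + \<theta> + q - 1) ^ 3)
      = padic_norm (\<theta> + q) * padic_norm (\<theta> * x + q) / padic_norm (x + \<theta> + q - 1) ^ 3"
    by (simp only: padic_norm_divide padic_norm_mult padic_norm_power padic_norm_two[OF assms(1)] mult_1)
  moreover have "padic_norm (x + \<theta> + q - 1) ^ 2 * padic_norm x = padic_norm (\<theta> * x + q) ^ 2"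
    using fp(2) by (metis padic_norm_mult padic_norm_power)
  ultimately show ?thesis using that potts_map_derivative fp by blast
qed

section \<open>Norms of the roots and the classification\<close>

text \<open>If |a| and |b| differed, the larger would equal |a + b| \<le> 1 and the smaller would be
  below 1, contradicting |a b| = 1. Equal norms with product 1 are 1.\<close>

lemma padic_norm_roots_eq_1:
  fixes a b :: "'p::prime_card padic"
  assumes "padic_norm (a + b) \<le> 1" "padic_norm (a * b) = 1"
  shows "padic_norm a = 1"
proof -
  have m: "padic_norm a * padic_norm b = 1" using assms(2) by (simp add: padic_norm_mult)
  have pos: "padic_norm a > 0" "padic_norm b > 0"
    using m padic_norm_nonneg[of a] padic_norm_nonneg[of b] by (auto simp: less_le)
  have "padic_norm a = padic_norm b"
  proof (rule ccontr)
    assume "padic_norm a \<noteq> padic_norm b"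
    then have "padic_norm a < padic_norm b \<or> padic_norm b < padic_norm a" by linarith
    then have le: "padic_norm a \<le> 1" "padic_norm b \<le> 1"
      and less: "padic_norm a < 1 \<or> padic_norm b < 1"
      using padic_norm_add_eq[of a b] padic_norm_add_eq[of b a] assms(1) by (auto simp: add.commute)
    have "padic_norm a * padic_norm b \<le> padic_norm a" "padic_norm a * padic_norm b \<le> padic_norm b"
      using le by (simp_all add: mult_left_le mult_left_le_one_le)
    then have "padic_norm a * padic_norm b < 1" using less by linarith
    then show False using m by simp
  qed
  then have "padic_norm a ^ 2 = 1" using m by (simp add: power2_eq_square)
  then show ?thesis using pos by (simp add: power2_eq_1_iff)
qed

theorem proposition5p2:
  fixes p N :: nat and q :: int and \<theta> Q x0 x1 x2 :: "'p::prime_card padic"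
  assumes "p = CARD('p)" and "p \<ge> 3" and "q \<ge> 1" and "N \<ge> 1"
    and "\<theta> = of_nat p ^ N" and "Q = of_int q"
    and "x0 = 1"
    and "\<forall>x. x ^ 2 + (2 * \<theta> - \<theta> ^ 2 + 2 * Q - 1) * x + Q ^ 2 = (x - x1) * (x - x2)"
    and "padic_norm Q < 1 \<longrightarrow> padic_norm x1 = padic_norm Q ^ 2 \<and> padic_norm x2 = 1"
  shows "(padic_norm Q = 1 \<longrightarrow>
            neutral (potts_map \<theta> Q) x0 \<and> neutral (potts_map \<theta> Q) x1 \<and>
            neutral (potts_map \<theta> Q) x2) \<and>
         (padic_norm Q < 1 \<and> padic_norm \<theta> \<le> padic_norm Q ^ 2 \<longrightarrow>
            attractive (potts_map \<theta> Q) x1 \<and>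
            repelling (potts_map \<theta> Q) x0 \<and> repelling (potts_map \<theta> Q) x2)"
proof -
  let ?D = "\<lambda>x. x + \<theta> + Q - 1"
  have p3: "CARD('p) \<ge> 3" using assms(1,2) by simp
  have \<theta>: "padic_norm \<theta> < 1"
    using p3 assms(4) by (simp add: assms(1,5) padic_norm_power padic_norm_CARD power_less_one_iff)
  have "\<theta> + Q = of_int (int p ^ N + q)" by (simp add: assms(5,6))
  moreover have "int p ^ N + q \<noteq> 0" using assms(3) zero_le_power[of "int p" N] by linarith
  ultimately have \<theta>Q: "\<theta> + Q \<noteq> 0" by (metis of_int_eq_0_iff)
  have Q: "padic_norm Q > 0" using assms(3,6) padic_norm_nonneg[of Q] by (simp add: less_le)
  have quad: "x1 ^ 2 + (2 * \<theta> - \<theta> ^ 2 + 2 * Q - 1) * x1 + Q ^ 2 = 0"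
    "x2 ^ 2 + (2 * \<theta> - \<theta> ^ 2 + 2 * Q - 1) * x2 + Q ^ 2 = 0"
    using assms(8) by simp_all
  \<comment> \<open>Vieta's formulas, read off from the factorization at 0 and then at 1. The sum is
    an integer, hence of norm at most 1.\<close>
  have prod: "x1 * x2 = Q ^ 2" using assms(8)[rule_format, of 0] by simp
  have sum: "x1 + x2 = of_int (1 - 2 * q + (int p ^ N) ^ 2 - 2 * int p ^ N)"
    using assms(8)[rule_format, of 1] prod by (simp add: assms(5,6) algebra_simps)
  have small: "padic_norm (\<theta> * x + Q) = padic_norm Q"
    if "padic_norm \<theta> * padic_norm x < padic_norm Q" for x
    using padic_norm_add_eq[of "\<theta> * x" Q] that by (simp add: padic_norm_mult add.commute)
  note multiplier = potts_map_multiplier[OF p3 \<theta> \<theta>Q]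
  have neutral: "neutral (potts_map \<theta> Q) x"
    if norms: "padic_norm Q = 1" "padic_norm x = 1"
      and fixed: "x = 1 \<or> x ^ 2 + (2 * \<theta> - \<theta> ^ 2 + 2 * Q - 1) * x + Q ^ 2 = 0" for x
  proof -
    have n: "padic_norm (\<theta> * x + Q) = 1" "padic_norm (\<theta> + Q) = 1"
      using small[of x] small[of 1] \<theta> norms by simp_all
    obtain l where l: "has_padic_derivative (potts_map \<theta> Q) l x" "potts_map \<theta> Q x = x"
      "padic_norm l = padic_norm (\<theta> + Q) * padic_norm (\<theta> * x + Q) / padic_norm (?D x) ^ 3"
      "padic_norm (?D x) ^ 2 * padic_norm x = padic_norm (\<theta> * x + Q) ^ 2"
      using multiplier[OF fixed] by metis
    have "padic_norm (?D x) = 1"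
      using l(4) n norms(2) padic_norm_nonneg[of "?D x"] by (simp add: power2_eq_1_iff)
    then show ?thesis unfolding neutral_def using l n by auto
  qed
  have "neutral (potts_map \<theta> Q) x0 \<and> neutral (potts_map \<theta> Q) x1 \<and> neutral (potts_map \<theta> Q) x2"
    if q1: "padic_norm Q = 1"
  proof -
    \<comment> \<open>The labelling of the roots says nothing when |Q| = 1; their norms come from
      the integral sum and the unit product.\<close>
    have s: "padic_norm (x1 + x2) \<le> 1" unfolding sum by (rule padic_norm_of_int_le_1)
    have pr: "padic_norm (x1 * x2) = 1" by (simp add: prod padic_norm_power q1)
    have "padic_norm x1 = 1" using padic_norm_roots_eq_1[OF s pr] .
    moreover have "padic_norm x2 = 1"
      using padic_norm_roots_eq_1[of x2 x1] s pr by (simp add: ac_simps)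
    ultimately show ?thesis using neutral q1 quad assms(7) by simp
  qed
  moreover have "attractive (potts_map \<theta> Q) x1 \<and> repelling (potts_map \<theta> Q) x0 \<and> repelling (potts_map \<theta> Q) x2"
    if q1: "padic_norm Q < 1" and \<theta>q: "padic_norm \<theta> \<le> padic_norm Q ^ 2"
  proof -
    have x1: "padic_norm x1 = padic_norm Q ^ 2" and x2: "padic_norm x2 = 1" using assms(9) q1 by auto
    have "padic_norm Q ^ 2 < padic_norm Q"
      using Q q1 by (simp add: power2_eq_square)
    then have lt: "padic_norm \<theta> < padic_norm Q" using \<theta>q by linarith
    \<comment> \<open>The closed unit ball contains all three fixed points.\<close>
    have n: "padic_norm (\<theta> * x + Q) = padic_norm Q" if "padic_norm x \<le> 1" for x
      using small[of x] mult_left_mono[OF that padic_norm_nonneg[of \<theta>]] lt by simp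
    have n0: "padic_norm (\<theta> + Q) = padic_norm Q" using n[of 1] by simp
    have x1': "padic_norm x1 \<le> 1" using x1 q1 Q by (simp add: power_le_one)
    obtain l1 where l1: "has_padic_derivative (potts_map \<theta> Q) l1 x1" "potts_map \<theta> Q x1 = x1"
      "padic_norm l1 = padic_norm (\<theta> + Q) * padic_norm (\<theta> * x1 + Q) / padic_norm (?D x1) ^ 3"
      "padic_norm (?D x1) ^ 2 * padic_norm x1 = padic_norm (\<theta> * x1 + Q) ^ 2"
      using multiplier[OF disjI2[OF quad(1)]] by metis
    \<comment> \<open>The fixed point equation reads |D|^2 |Q|^2 = |Q|^2. With |D| = 1 the
      multiplier has norm |Q|^2.\<close>
    have "padic_norm (?D x1) ^ 2 = 1"
      using l1(4) Q by (auto simp: x1 n[OF x1'])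
    then have "padic_norm (?D x1) = 1"
      using padic_norm_nonneg[of "?D x1"] unfolding power2_eq_1_iff by linarith
    then have "padic_norm l1 < 1"
      using l1(3) Q q1 by (simp add: n[OF x1'] n0 power_less_one_iff flip: power2_eq_square)
    moreover
    have rep: "repelling (potts_map \<theta> Q) x" if norm_x: "padic_norm x = 1"
      and fixed: "x = 1 \<or> x ^ 2 + (2 * \<theta> - \<theta> ^ 2 + 2 * Q - 1) * x + Q ^ 2 = 0" for x
    proof -
      obtain l where l: "has_padic_derivative (potts_map \<theta> Q) l x" "potts_map \<theta> Q x = x"
        "padic_norm l = padic_norm (\<theta> + Q) * padic_norm (\<theta> * x + Q) / padic_norm (?D x) ^ 3"
        "padic_norm (?D x) ^ 2 * padic_norm x = padic_norm (\<theta> * x + Q) ^ 2"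
        using multiplier[OF fixed] by metis
      have nx: "padic_norm (\<theta> * x + Q) = padic_norm Q" using n norm_x by simp
      \<comment> \<open>Now |x| = 1 makes D as small as Q, and the multiplier has norm |Q|^2 /
        |Q|^3.\<close>
      have "padic_norm (?D x) ^ 2 = padic_norm Q ^ 2" using l(4) by (simp add: norm_x nx)
      then have "padic_norm (?D x) = padic_norm Q"
        by (rule power2_eq_imp_eq) auto
      then have "padic_norm l = 1 / padic_norm Q"
        using l(3) Q by (simp add: nx n0 power3_eq_cube)
      then show ?thesis unfolding repelling_def using l Q q1 by auto
    qed
    ultimately show ?thesis
      using l1 rep[of x0] rep[OF x2 disjI2[OF quad(2)]] assms(7) unfolding attractive_def by auto
  qed
  ultimately show ?thesis by blast
qed

end
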